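(* Let $\mathbb{R}_{-}^{\star}=\{x\in\mathbb{R}: x<0\}$ with the law $x\cdot y=-xy$ for $x,y\in\mathbb{R}_{-}^{\star}$, where $xy$ on the right is the ordinary product of real numbers. Then $(\mathbb{R}_{-}^{\star},\cdot)$ is a commutative group, isomorphic to the multiplicative group $\mathbb{R}_{+}^{\star}$ of positive real numbers and to the real vector group $(\mathbb{R},+)$. *)

theory Defs
  imports Complex_Main "HOL-Algebra.Group"
begin

(* A monoid record needs its unit as a field; for the law x . y = -(x * y) the unit is -1. *)
definition neg_real_group :: "real monoid"
  where "neg_real_group = \<lparr>carrier = {x. x < 0}, monoid.mult = (\<lambda>x y. - (x * y)), one = -1\<rparr>"

definition pos_real_mult_group :: "real monoid"
  where "pos_real_mult_group = \<lparr>carrier = {x. 0 < x}, monoid.mult = (*), one = 1\<rparr>"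

definition real_add_group :: "real monoid"
  where "real_add_group = \<lparr>carrier = UNIV, monoid.mult = (+), one = 0\<rparr>"

(* The relation is_iso only asks for a bijective homomorphism of monoid records and does not
   itself make either side a group, so this is established for the two target groups. *)
lemma comm_group_pos_real_mult_group: "comm_group pos_real_mult_group"
proof (rule comm_groupI)
  fix x assume "x \<in> carrier pos_real_mult_group"
  then show "\<exists>y\<in>carrier pos_real_mult_group.
      y \<otimes>\<^bsub>pos_real_mult_group\<^esub> x = \<one>\<^bsub>pos_real_mult_group\<^esub>"
    by (intro bexI[of _ "inverse x"]) (auto simp: pos_real_mult_group_def)
qed (auto simp: pos_real_mult_group_def)

lemma comm_group_real_add_group: "comm_group real_add_group"
proof (rule comm_groupI)
  fix x assume "x \<in> carrier real_add_group"
  show "\<exists>y\<in>carrier real_add_group. y \<otimes>\<^bsub>real_add_group\<^esub> x = \<one>\<^bsub>real_add_group\<^esub>"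
    by (intro bexI[of _ "- x"]) (auto simp: real_add_group_def)
qed (auto simp: real_add_group_def)

end

theory Submission
  imports Defs
begin

text \<open>The law \<open>-(x * y)\<close> is ordinary multiplication transported along negation:
  \<open>-(x * y) = -((-x) * (-y))\<close>. Hence \<open>x \<mapsto> -x\<close> identifies the negative half-line with
  the multiplicative group of positive reals, the unit being \<open>-1\<close>; following it by the
  logarithm gives the isomorphism \<open>x \<mapsto> ln (-x)\<close> onto the additive group.\<close>

lemma comm_group_neg_real_group: "comm_group neg_real_group"
proof (rule comm_groupI)
  fix x assume "x \<in> carrier neg_real_group"
  then show "\<exists>y\<in>carrier neg_real_group. y \<otimes>\<^bsub>neg_real_group\<^esub> x = \<one>\<^bsub>neg_real_group\<^esub>"
    by (intro bexI[of _ "inverse x"]) (auto simp: neg_real_group_def)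
qed (auto simp: neg_real_group_def mult_neg_neg)

lemma uminus_iso: "uminus \<in> iso neg_real_group pos_real_mult_group"
proof (rule isoI)
  show "uminus \<in> hom neg_real_group pos_real_mult_group"
    by (auto simp: hom_def neg_real_group_def pos_real_mult_group_def)
  show "bij_betw uminus (carrier neg_real_group) (carrier pos_real_mult_group)"
    by (rule bij_betw_byWitness[where f' = uminus])
      (auto simp: neg_real_group_def pos_real_mult_group_def)
qed

lemma ln_iso: "ln \<in> iso pos_real_mult_group real_add_group"
proof (rule isoI)
  show "ln \<in> hom pos_real_mult_group real_add_group"
    by (auto simp: hom_def pos_real_mult_group_def real_add_group_def ln_mult)
  show "bij_betw ln (carrier pos_real_mult_group) (carrier real_add_group)"
    by (rule bij_betw_byWitness[where f' = exp])
      (auto simp: pos_real_mult_group_def real_add_group_def)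
qed

theorem mainTheorem6:
  shows "comm_group neg_real_group \<and>
    neg_real_group \<cong> pos_real_mult_group \<and>
    neg_real_group \<cong> real_add_group"
  using comm_group_neg_real_group is_isoI[OF uminus_iso]
    is_isoI[OF iso_set_trans[OF uminus_iso ln_iso]]
  by blast

end
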